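(* Let $\{P_\theta\}_{\theta\in\Theta}$ be a family of probability measures on a measurable space $(\Omega,\mathcal{F})$ with a filtration $(\mathcal{F}_n)_{n\ge0}$, where $\Theta$ is partitioned into $\Theta_0$ (null) and $\Theta_1$ (alternative). Let $(S_n)$ be a sequence of statistics such that, for each $n$, $S_n$ is sufficient for $\Theta$ with respect to $\mathcal{F}_n$. Let $(E_n)$ be an asymptotic e-variable (respectively, a uniform asymptotic e-variable) for $\Theta_0$, with $E_n$ being $\mathcal{F}_n$-measurable for each $n$. For each $n$, set $G_n=\mathbb{E}_\Theta[E_n\mid S_n]$. Then (i) $(G_n)$ is an asymptotic e-variable (respectively, a uniform asymptotic e-variable) for $\Theta_0$, and (ii) $\mathbb{E}_\theta[f(G_n)]\ge\mathbb{E}_\theta[f(E_n)]$ for all $n$, all $\theta\in\Theta$ and all concave utility functions $f$, assuming both expectations are defined. Moreover, $\mathbb{E}_\theta[\log(E_n/G_n)]\le0$ for all $n$ and $\theta\in\Theta$.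
   Context: Random variables are measurable functions on $\Omega$ with values in $[-\infty,\infty]$; $\mathbb{E}_\theta$ denotes expectation under $P_\theta$. The expectation $\mathbb{E}[Y]$ is defined as an element of $[-\infty,\infty]$ if $\mathbb{E}[Y^+]$ or $\mathbb{E}[Y^-]$ is finite; generalized conditional expectations then exist (in particular for all $Y\ge 0$). An asymptotic e-variable for $\Theta_0$ is a sequence $(E_n)$ of nonnegative ($[0,\infty]$-valued) random variables with $\sup_{\theta\in\Theta_0}\limsup_{n\to\infty}\mathbb{E}_\theta[E_n]\le1$. A uniform asymptotic e-variable for $\Theta_0$ is such a sequence with $\limsup_{n\to\infty}\sup_{\theta\in\Theta_0}\mathbb{E}_\theta[E_n]\le1$. An $\mathcal{F}_n$-measurable statistic $S_n$ (with values in a measurable space) is sufficient for $\Theta$ with respect to $\mathcal{F}_n$ if for every $\mathcal{F}_n$-measurable random variable $h$ there is a measurable function $g_h$ with $\mathbb{E}_\theta[h\mid S_n]=g_h(S_n)$ $P_\theta$-a.s. for all $\theta\in\Theta$, whenever these conditional expectations exist (in particular whenever $h\ge0$). The common version $g_h(S_n)$ is denoted $\mathbb{E}_\Theta[h\mid S_n]$. A concave utility function is a concave function $f:(0,\infty)\to\mathbb{R}$, extended to $f:[0,\infty]\to[-\infty,\infty]$ by $f(0):=\lim_{x\downarrow 0}f(x)$ and $f(\infty):=\lim_{x\to\infty}f(x)$. Ratios use the conventions $0/0=0$ and $\infty/\infty=1$; also $\log 0=-\infty$, $\log\infty=\infty$. *)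

theory Defs
  imports "HOL-Probability.Probability"
begin

text \<open>
  Random variables with values in \<open>[-\<infinity>, \<infinity>]\<close> have type \<open>'a \<Rightarrow> ereal\<close>, nonnegative ones
  (values in \<open>[0, \<infinity>]\<close>) type \<open>'a \<Rightarrow> ennreal\<close>.  Since \<open>e2ennreal\<close> sends negative numbers to \<open>0\<close>,
  \<open>e2ennreal y\<close> and \<open>e2ennreal (- y)\<close> are the positive and the negative part of \<open>y\<close>.
\<close>

definition expectation_defined :: "'a measure \<Rightarrow> ('a \<Rightarrow> ereal) \<Rightarrow> bool" where
  "expectation_defined P Y \<longleftrightarrow>
     (\<integral>\<^sup>+ \<omega>. e2ennreal (Y \<omega>) \<partial>P) < \<infinity> \<or> (\<integral>\<^sup>+ \<omega>. e2ennreal (- Y \<omega>) \<partial>P) < \<infinity>"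

text \<open>Only meaningful under \<^const>\<open>expectation_defined\<close>: otherwise it is \<open>\<infinity> - \<infinity>\<close>.\<close>

definition ext_expectation :: "'a measure \<Rightarrow> ('a \<Rightarrow> ereal) \<Rightarrow> ereal" where
  "ext_expectation P Y =
     enn2ereal (\<integral>\<^sup>+ \<omega>. e2ennreal (Y \<omega>) \<partial>P) - enn2ereal (\<integral>\<^sup>+ \<omega>. e2ennreal (- Y \<omega>) \<partial>P)"

text \<open>
  Generalized conditional expectation.  Under \<^const>\<open>expectation_defined\<close> the two terms are almost
  surely not both infinite.
\<close>

definition ext_cond_exp :: "'a measure \<Rightarrow> 'a measure \<Rightarrow> ('a \<Rightarrow> ereal) \<Rightarrow> 'a \<Rightarrow> ereal" where
  "ext_cond_exp P F Y \<omega> =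
     enn2ereal (nn_cond_exp P F (\<lambda>x. e2ennreal (Y x)) \<omega>) -
     enn2ereal (nn_cond_exp P F (\<lambda>x. e2ennreal (- Y x)) \<omega>)"

text \<open>
  \<open>H\<close> is a version \<open>g(S)\<close> of the conditional expectation of \<open>h\<close> given \<open>\<sigma>(S)\<close> that is common to all
  \<open>\<theta> \<in> \<Theta>\<close> for which that conditional expectation exists.
\<close>

definition common_cond_exp ::
  "('t \<Rightarrow> 'a measure) \<Rightarrow> 't set \<Rightarrow> 'a measure \<Rightarrow> 's measure \<Rightarrow> ('a \<Rightarrow> 's) \<Rightarrow> ('a \<Rightarrow> ereal) \<Rightarrow> ('a \<Rightarrow> ereal) \<Rightarrow> bool"
where
  "common_cond_exp P \<Theta> F N S h H \<longleftrightarrow>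
     (\<exists>g \<in> borel_measurable N.
        (\<forall>\<omega>\<in>space F. H \<omega> = g (S \<omega>)) \<and>
        (\<forall>\<theta>\<in>\<Theta>. expectation_defined (P \<theta>) h \<longrightarrow>
           (AE \<omega> in P \<theta>. ext_cond_exp (P \<theta>) (vimage_algebra (space F) S N) h \<omega> = g (S \<omega>))))"

definition sufficient_statistic ::
  "('t \<Rightarrow> 'a measure) \<Rightarrow> 't set \<Rightarrow> 'a measure \<Rightarrow> 's measure \<Rightarrow> ('a \<Rightarrow> 's) \<Rightarrow> bool"
where
  "sufficient_statistic P \<Theta> F N S \<longleftrightarrow>
     S \<in> F \<rightarrow>\<^sub>M N \<and> (\<forall>h \<in> borel_measurable F. \<exists>H. common_cond_exp P \<Theta> F N S h H)"

definition asymptotic_evariable ::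
  "'a measure \<Rightarrow> ('t \<Rightarrow> 'a measure) \<Rightarrow> 't set \<Rightarrow> (nat \<Rightarrow> 'a \<Rightarrow> ennreal) \<Rightarrow> bool"
where
  "asymptotic_evariable M P \<Theta>0 E \<longleftrightarrow>
     (\<forall>n. E n \<in> borel_measurable M) \<and>
     (SUP \<theta>\<in>\<Theta>0. limsup (\<lambda>n. \<integral>\<^sup>+ \<omega>. E n \<omega> \<partial>P \<theta>)) \<le> 1"

definition uniform_asymptotic_evariable ::
  "'a measure \<Rightarrow> ('t \<Rightarrow> 'a measure) \<Rightarrow> 't set \<Rightarrow> (nat \<Rightarrow> 'a \<Rightarrow> ennreal) \<Rightarrow> bool"
where
  "uniform_asymptotic_evariable M P \<Theta>0 E \<longleftrightarrow>
     (\<forall>n. E n \<in> borel_measurable M) \<and>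
     limsup (\<lambda>n. SUP \<theta>\<in>\<Theta>0. \<integral>\<^sup>+ \<omega>. E n \<omega> \<partial>P \<theta>) \<le> 1"

text \<open>
  A concave utility function is given by \<open>f :: real \<Rightarrow> real\<close> with \<open>concave_on {0<..} f\<close> (values of \<open>f\<close>
  outside \<open>{0<..}\<close> are irrelevant); this is its extension to \<open>[0, \<infinity>]\<close>.  Concavity makes both limits
  exist in \<open>[-\<infinity>, \<infinity>]\<close>.
\<close>

definition utility_ext :: "(real \<Rightarrow> real) \<Rightarrow> ennreal \<Rightarrow> ereal" where
  "utility_ext f x =
     (if x = 0 then Lim (at_right 0) (\<lambda>t. ereal (f t))
      else if x = \<infinity> then Lim at_top (\<lambda>t. ereal (f t))
      else ereal (f (enn2real x)))"

definition log_ext :: "ennreal \<Rightarrow> ereal" where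
  "log_ext x = (if x = 0 then - \<infinity> else if x = \<infinity> then \<infinity> else ereal (ln (enn2real x)))"

text \<open>The library has \<open>0 / 0 = 0\<close> on \<^typ>\<open>ennreal\<close>, but \<open>\<infinity> / \<infinity> = 0\<close>.\<close>

definition ratio :: "ennreal \<Rightarrow> ennreal \<Rightarrow> ennreal" where
  "ratio x y = (if x = \<infinity> \<and> y = \<infinity> then 1 else x / y)"

text \<open>For a sufficient statistic, a nonnegative \<open>E\<close> has a nonnegative common version.\<close>

lemma sufficient_statistic_nonneg_version:
  assumes suff: "sufficient_statistic P \<Theta> F N S"
    and E: "E \<in> borel_measurable F"
    and P: "\<And>\<theta>. \<theta> \<in> \<Theta> \<Longrightarrow> prob_space (P \<theta>)" "\<And>\<theta>. \<theta> \<in> \<Theta> \<Longrightarrow> subalgebra (P \<theta>) F"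
  shows "\<exists>G :: 'a \<Rightarrow> ennreal.
    common_cond_exp P \<Theta> F N S (\<lambda>\<omega>. enn2ereal (E \<omega>)) (\<lambda>\<omega>. enn2ereal (G \<omega>))"
proof -
  let ?V = "vimage_algebra (space F) S N"
  let ?h = "\<lambda>\<omega>. enn2ereal (E \<omega>)"
  from suff have S: "S \<in> F \<rightarrow>\<^sub>M N" by (simp add: sufficient_statistic_def)
  have "?h \<in> borel_measurable F" using E by measurable
  with suff obtain g where g: "g \<in> borel_measurable N"
    and eq: "\<And>\<theta>. \<theta> \<in> \<Theta> \<Longrightarrow> expectation_defined (P \<theta>) ?h \<Longrightarrow>
      AE \<omega> in P \<theta>. ext_cond_exp (P \<theta>) ?V ?h \<omega> = g (S \<omega>)"
    unfolding sufficient_statistic_def common_cond_exp_def by blast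
  have neg: "e2ennreal (- enn2ereal x) = 0" for x
    by (simp add: e2ennreal_neg)
  have "common_cond_exp P \<Theta> F N S ?h (\<lambda>\<omega>. enn2ereal (e2ennreal (g (S \<omega>))))"
    unfolding common_cond_exp_def
  proof (intro bexI[of _ "\<lambda>s. enn2ereal (e2ennreal (g s))"] conjI ballI impI)
    fix \<theta> assume \<theta>: "\<theta> \<in> \<Theta>" and d: "expectation_defined (P \<theta>) ?h"
    interpret prob_space "P \<theta>" by (rule P(1)[OF \<theta>])
    have "sets ?V \<subseteq> sets F"
      using S unfolding sets_vimage_algebra
      by (intro sets.sigma_sets_subset) (auto simp: measurable_sets)
    hence sub: "subalgebra (P \<theta>) ?V"
      using P(2)[OF \<theta>] by (auto simp: subalgebra_def)
    interpret finite_measure_subalgebra "P \<theta>" ?V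
      by standard (rule sub)
    have "AE \<omega> in P \<theta>. 0 = nn_cond_exp (P \<theta>) ?V (\<lambda>_. 0) \<omega>"
      by (rule nn_cond_exp_F_meas) simp
    thus "AE \<omega> in P \<theta>. ext_cond_exp (P \<theta>) ?V ?h \<omega> = enn2ereal (e2ennreal (g (S \<omega>)))"
      using eq[OF \<theta> d]
    proof eventually_elim
      case (elim \<omega>)
      have "0 \<le> g (S \<omega>)"
        unfolding elim(2)[symmetric] by (simp add: ext_cond_exp_def neg elim(1)[symmetric] zero_ennreal.rep_eq)
      with elim(2) show ?case by (simp add: enn2ereal_e2ennreal)
    qed
  qed (use g in measurable)
  thus ?thesis by (intro exI[of _ "\<lambda>\<omega>. e2ennreal (g (S \<omega>))"])
qed

end

theory Submission
  imports Defs
begin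

text \<open>
  Each \<open>G\<^sub>n\<close> is, under every \<open>P\<^sub>\<theta>\<close>, a version of the conditional expectation of \<open>E\<^sub>n\<close>
  given \<open>\<sigma>(S\<^sub>n)\<close>, so the means agree.  Jensen's inequality has to cover nonintegrable \<open>E\<^sub>n\<close> and utilities
  that are infinite at \<open>0\<close> and \<open>\<infinity>\<close>.  With \<open>C\<close> the conditional expectation
  given \<open>S\<close>, it is therefore proved without subtraction, as
  \<open>C(f(E)\<^sup>+) + f(G)\<^sup>- \<le> C(f(E)\<^sup>-) + f(G)\<^sup>+\<close>, by conditioning the tangent line of \<open>f\<close> at \<open>G\<close>
  where \<open>0 < G < \<infinity>\<close>.  Where \<open>G = 0\<close>, also \<open>E = 0\<close> almost surely; where \<open>G = \<infinity>\<close>, either \<open>f\<close> is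
  nondecreasing and \<open>f(E) \<le> f(\<infinity>)\<close>, or \<open>f\<close> lies below a line of negative slope and
  \<open>C(f(E)\<^sup>-) = \<infinity>\<close>.  The logarithmic bound follows from \<open>E / G\<close> having mean at most \<open>1\<close> and \<open>ln r \<le> r - 1\<close>.
\<close>

section \<open>Inequalities with positive and negative parts kept on opposite sides\<close>

text \<open>\<open>ennreal c\<close> and \<open>ennreal (- c)\<close> are the positive and negative
  parts of a real \<open>c\<close>. Passing from separate \<open>a\<close> and \<open>b\<close> to
  \<open>a + b * r\<close> removes the same finite amount from both sides. The left form can be
  conditioned term by term; the right form compares with the value at \<open>r\<close>.\<close>

lemma ennreal_affine_le_iff:
  assumes "0 \<le> r"
  shows "p + ennreal (- a) + ennreal (- b) * ennreal r \<le> q + ennreal a + ennreal b * ennreal r \<longleftrightarrow>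
    p + ennreal (- (a + b * r)) \<le> q + ennreal (a + b * r)"
proof (cases p; cases q)
  fix p' q' :: real
  assume pq: "0 \<le> p'" "p = ennreal p'" "0 \<le> q'" "q = ennreal q'"
  have lhs: "x + ennreal c + ennreal e * ennreal r = ennreal (x' + max c 0 + max e 0 * r)"
    if "x = ennreal x'" "0 \<le> x'" for x x' c e
    using that assms by (simp add: ennreal_plus ennreal_mult)
  have rhs: "x + ennreal c = ennreal (x' + max c 0)" if "x = ennreal x'" "0 \<le> x'" for x x' c
    using that by (simp add: ennreal_plus)
  have b: "max b 0 * r - max (- b) 0 * r = b * r"
    by (auto simp: max_def)
  have pos_neg: "max c 0 - max (- c) 0 = c" for c :: real
    by (auto simp: max_def)
  have "?thesis \<longleftrightarrow> (p' + max (- a) 0 + max (- b) 0 * r \<le> q' + max a 0 + max b 0 * r \<longleftrightarrow>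
      p' + max (- (a + b * r)) 0 \<le> q' + max (a + b * r) 0)"
    unfolding lhs[OF pq(2,1)] lhs[OF pq(4,3)] unfolding rhs[OF pq(2,1)] rhs[OF pq(4,3)]
    using pq assms by (subst (1 2) ennreal_le_iff) auto
  then show ?thesis
    using b pos_neg[of a] pos_neg[of "a + b * r"] by linarith
qed (auto simp: top_unique ennreal_mult_eq_top_iff)

text \<open>Returns to differences once all estimates are done. The finiteness assumptions exclude
  undefined differences: infinite \<open>p\<close> then forces \<open>r\<close> infinite, and
  infinite \<open>s\<close> forces \<open>q\<close> infinite.\<close>

lemma ereal_diff_le_diffI:
  fixes p q r s :: ennreal
  assumes "p + s \<le> q + r" and "p < \<infinity> \<or> q < \<infinity>" and "r < \<infinity> \<or> s < \<infinity>"
  shows "enn2ereal p - enn2ereal q \<le> enn2ereal r - enn2ereal s"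
  using assms
  by (cases p; cases q; cases r; cases s)
    (auto simp: ennreal_plus[symmetric] enn2ereal_ennreal top_unique simp del: ennreal_plus)

section \<open>Supergradients and boundary values of concave utilities\<close>

text \<open>The tangency point will be random, and the slope there has to come out of a conditional
  expectation, so a measurable choice of slope is required. Monotonicity of the slopes supplies
  it.\<close>

lemma concave_on_supergradient:
  fixes f :: "real \<Rightarrow> real"
  assumes "concave_on {0<..} f"
  obtains d where "d \<in> borel_measurable borel"
    and "\<forall>x>0. \<forall>y>0. f y \<le> f x + d x * (y - x)"
proof -
  \<comment> \<open>On \<open>{0<..}\<close> this is the right derivative of the convex function
    \<open>- f\<close>, written as the infimum of its slopes to the right.\<close>
  define e where "e x = Inf ((\<lambda>t. (- f x - - f t) / (x - t)) ` ({x<..} \<inter> {0<..}))" for x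
  have e: "f y \<le> f x - e x * (y - x)" if "0 < x" "0 < y" for x y
    using convex_le_Inf_differential[of "{0<..}" "\<lambda>x. - f x" x y] assms that
    by (simp add: concave_on_def e_def interior_open)
  have "mono_on {0<..} e"
  proof (rule mono_onI)
    fix x y :: real assume "x \<in> {0<..}" "y \<in> {0<..}" "x \<le> y"
    then show "e x \<le> e y"
    proof (cases "x = y")
      case False
      have "0 \<le> (e y - e x) * (y - x)"
        using e[of x y] e[of y x] \<open>x \<in> _\<close> \<open>y \<in> _\<close> by (simp add: algebra_simps)
      with False \<open>x \<le> y\<close> show ?thesis by (simp add: zero_le_mult_iff)
    qed simp
  qed
  then have "e \<in> borel_measurable (restrict_space borel {0<..})"
    by (rule borel_measurable_mono_on_fnc)
  \<comment> \<open>The indicator extends \<open>- e\<close> by 0 to a Borel function on the whole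
    line.\<close>
  then have "(\<lambda>x. - (indicator {0<..} x *\<^sub>R e x)) \<in> borel_measurable borel"
    by (simp add: borel_measurable_restrict_space_iff)
  then show thesis
    by (rule that) (use e in auto)
qed

text \<open>By completeness of \<open>ereal\<close>, the limit is the infimum over the interval in
  the increasing case and the supremum in the decreasing case.\<close>

lemma monotone_tendsto_at_right_0:
  fixes g :: "real \<Rightarrow> ereal"
  assumes "0 < c" and "mono_on {0<..<c} g \<or> antimono_on {0<..<c} g"
  shows "\<exists>L. (g \<longlongrightarrow> L) (at_right 0)"
proof -
  have near: "eventually (\<lambda>t. 0 < t \<and> t < s) (at_right 0)" if "0 < s" for s :: real
    using eventually_at_right_real[OF that] by simp
  from assms(2) show ?thesis
  proof
    assume g: "mono_on {0<..<c} g"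
    show ?thesis
    proof (intro exI decreasing_tendsto)
      show "eventually (\<lambda>t. (INF s\<in>{0<..<c}. g s) \<le> g t) (at_right 0)"
        using near[OF \<open>0 < c\<close>] by eventually_elim (auto intro: INF_lower)
    next
      fix x assume "(INF s\<in>{0<..<c}. g s) < x"
      then obtain s where s: "0 < s" "s < c" "g s < x" by (auto simp: INF_less_iff)
      show "eventually (\<lambda>t. g t < x) (at_right 0)"
        using near[OF \<open>0 < s\<close>]
      proof eventually_elim
        case (elim t)
        then have "g t \<le> g s" using s by (intro mono_onD[OF g]) auto
        then show ?case using s(3) by (rule le_less_trans)
      qed
    qed
  next
    assume g: "antimono_on {0<..<c} g"
    show ?thesis
    proof (intro exI increasing_tendsto)
      show "eventually (\<lambda>t. g t \<le> (SUP s\<in>{0<..<c}. g s)) (at_right 0)"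
        using near[OF \<open>0 < c\<close>] by eventually_elim (auto intro: SUP_upper)
    next
      fix x assume "x < (SUP s\<in>{0<..<c}. g s)"
      then obtain s where s: "0 < s" "s < c" "x < g s" by (auto simp: less_SUP_iff)
      show "eventually (\<lambda>t. x < g t) (at_right 0)"
        using near[OF \<open>0 < s\<close>]
      proof eventually_elim
        case (elim t)
        then have "g s \<le> g t" using s monotone_onD[OF g, of t s] by auto
        with s(3) show ?case by (rule less_le_trans)
      qed
    qed
  qed
qed

lemma tendsto_MInfty_affine_bound:
  fixes f :: "real \<Rightarrow> real"
  assumes "b < 0" and bound: "\<And>y. 0 < y \<Longrightarrow> f y \<le> a + b * y"
  shows "((\<lambda>t. ereal (f t)) \<longlongrightarrow> - \<infinity>) at_top"
  unfolding tendsto_MInfty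
proof
  fix r
  show "eventually (\<lambda>t. ereal (f t) < ereal r) at_top"
    using eventually_gt_at_top[of 0] eventually_gt_at_top[of "(r - a) / b"]
  proof eventually_elim
    case (elim t)
    then have "a + b * t < r" using \<open>b < 0\<close> by (simp add: neg_divide_less_eq mult.commute)
    with bound[OF elim(1)] show ?case by simp
  qed
qed

context
  fixes f d :: "real \<Rightarrow> real"
  assumes supergradient_all: "\<forall>x>0. \<forall>y>0. f y \<le> f x + d x * (y - x)"
begin

lemma supergradient: "0 < x \<Longrightarrow> 0 < y \<Longrightarrow> f y \<le> f x + d x * (y - x)"
  using supergradient_all by blast

lemma supergradient_antimono:
  assumes "0 < x" "x \<le> y" shows "d y \<le> d x"
proof (cases "x = y")
  case False
  have "0 \<le> (d x - d y) * (y - x)"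
    using supergradient[of x y] supergradient[of y x] assms by (simp add: algebra_simps)
  with False assms show ?thesis by (simp add: zero_le_mult_iff)
qed simp

text \<open>A negative slope anywhere gives a falling tangent above \<open>f\<close>. If all slopes
  are nonnegative, the tangent at the larger of two points bounds \<open>f\<close> at the smaller
  one.\<close>

lemma supergradient_mono_or_affine_bound:
  "(\<forall>x y. 0 < x \<longrightarrow> x \<le> y \<longrightarrow> f x \<le> f y) \<or> (\<exists>a b. b < 0 \<and> (\<forall>y>0. f y \<le> a + b * y))"
proof (cases "\<exists>c>0. d c < 0")
  case True
  then obtain c where c: "0 < c" "d c < 0" by auto
  have "f y \<le> (f c - d c * c) + d c * y" if "0 < y" for y
    using supergradient[OF c(1) that] by (simp add: algebra_simps)
  with c(2) show ?thesis by blast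
next
  case False
  have "f x \<le> f y" if "0 < x" "x \<le> y" for x y
  proof -
    have "0 < y" using that by simp
    then have "0 \<le> d y" using False by (meson not_less)
    then have "d y * (x - y) \<le> 0" using that by (simp add: mult_nonneg_nonpos)
    with supergradient[OF \<open>0 < y\<close> \<open>0 < x\<close>] show ?thesis by simp
  qed
  then show ?thesis by blast
qed

text \<open>\<open>utility_ext\<close> is defined through \<open>Lim\<close>, so convergence must be
  established. Since slopes decrease, a nonnegative slope at \<open>c\<close> makes \<open>f\<close>
  nondecreasing on \<open>{0<..<c}\<close>; if there is none, \<open>f\<close> is nonincreasing
  throughout.\<close>

lemma tendsto_utility_ext_0: "((\<lambda>t. ereal (f t)) \<longlongrightarrow> utility_ext f 0) (at_right 0)"
proof -
  have "\<exists>c>0. mono_on {0<..<c} (\<lambda>t. ereal (f t)) \<or> antimono_on {0<..<c} (\<lambda>t. ereal (f t))"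
  proof (cases "\<exists>c>0. d c \<ge> 0")
    case True
    then obtain c where c: "0 < c" "0 \<le> d c" by auto
    have "f x \<le> f y" if "0 < x" "x \<le> y" "y < c" for x y
    proof -
      have "0 \<le> d y" using supergradient_antimono[of y c] c that by simp
      then have "d y * (x - y) \<le> 0" using that by (simp add: mult_nonneg_nonpos)
      with supergradient[of y x] that show ?thesis by simp
    qed
    then have "mono_on {0<..<c} (\<lambda>t. ereal (f t))" by (intro mono_onI) simp
    with c show ?thesis by blast
  next
    case False
    have "f y \<le> f x" if "0 < x" "x \<le> y" for x y
    proof -
      have "d x \<le> 0" using False \<open>0 < x\<close> by (meson linear)
      then have "d x * (y - x) \<le> 0" using that by (simp add: mult_nonpos_nonneg)
      with supergradient[of x y] that show ?thesis by simp
    qed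
    then have "antimono_on {0<..<1} (\<lambda>t. ereal (f t))" by (intro monotone_onI) simp
    then show ?thesis using zero_less_one by blast
  qed
  then obtain L where "((\<lambda>t. ereal (f t)) \<longlongrightarrow> L) (at_right 0)"
    using monotone_tendsto_at_right_0 by blast
  then show ?thesis by (simp add: utility_ext_def tendsto_Lim)
qed

text \<open>A nondecreasing \<open>f\<close> converges to its supremum; otherwise a line of negative
  slope forces the limit to be minus infinity.\<close>

lemma tendsto_utility_ext_top: "((\<lambda>t. ereal (f t)) \<longlongrightarrow> utility_ext f top) at_top"
proof -
  have "\<exists>L. ((\<lambda>t. ereal (f t)) \<longlongrightarrow> L) at_top"
    using supergradient_mono_or_affine_bound
  proof (elim disjE exE conjE)
    fix a b :: real assume "b < 0" "\<forall>y>0. f y \<le> a + b * y"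
    then have "((\<lambda>t. ereal (f t)) \<longlongrightarrow> - \<infinity>) at_top" using tendsto_MInfty_affine_bound by blast
    then show ?thesis by blast
  next
    assume mono: "\<forall>x y. 0 < x \<longrightarrow> x \<le> y \<longrightarrow> f x \<le> f y"
    show ?thesis
    proof (intro exI increasing_tendsto)
      show "eventually (\<lambda>t. ereal (f t) \<le> (SUP s\<in>{0<..}. ereal (f s))) at_top"
        using eventually_gt_at_top[of 0] by eventually_elim (auto intro: SUP_upper)
    next
      fix x assume "x < (SUP s\<in>{0<..}. ereal (f s))"
      then obtain s where s: "0 < s" "x < ereal (f s)" by (auto simp: less_SUP_iff)
      show "eventually (\<lambda>t. x < ereal (f t)) at_top"
        using eventually_ge_at_top[of s]
      proof eventually_elim
        case (elim t)
        then have "ereal (f s) \<le> ereal (f t)" using mono s by simp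
        with s(2) show ?case by (rule less_le_trans)
      qed
    qed
  qed
  then obtain L where "((\<lambda>t. ereal (f t)) \<longlongrightarrow> L) at_top" by blast
  then show ?thesis by (simp add: utility_ext_def tendsto_Lim)
qed

lemma utility_ext_le_top:
  assumes mono: "\<And>x y. 0 < x \<Longrightarrow> x \<le> y \<Longrightarrow> f x \<le> f y"
  shows "utility_ext f y \<le> utility_ext f top"
proof -
  have pos: "ereal (f x) \<le> utility_ext f top" if "0 < x" for x
  proof (rule tendsto_lowerbound[OF tendsto_utility_ext_top])
    show "eventually (\<lambda>t. ereal (f x) \<le> ereal (f t)) at_top"
      using eventually_ge_at_top[of x] by eventually_elim (use mono that in simp)
  qed simp
  have 0: "utility_ext f 0 \<le> utility_ext f top"
  proof (rule tendsto_upperbound[OF tendsto_utility_ext_0])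
    show "eventually (\<lambda>t. ereal (f t) \<le> utility_ext f top) (at_right 0)"
      using eventually_at_right_less[of 0] by eventually_elim (rule pos)
  qed simp
  consider "y = 0" | "y = top" | r where "y = ennreal r" "0 < r"
    by (cases y) (auto simp: less_le)
  then show ?thesis
    by cases (use 0 pos in \<open>simp_all add: utility_ext_def\<close>)
qed

text \<open>The affine bound carries over to all of \<open>ennreal\<close>, including both
  endpoints, once it is written without subtraction. In this form it can be conditioned even if
  nothing is integrable.\<close>

lemma utility_ext_affine_bound:
  assumes bound: "\<forall>y>0. f y \<le> a + b * y"
  shows "e2ennreal (utility_ext f y) + ennreal (- a) + ennreal (- b) * y
    \<le> e2ennreal (- utility_ext f y) + ennreal a + ennreal b * y"
proof -
  have real: "e2ennreal u + ennreal (- a) + ennreal (- b) * ennreal r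
      \<le> e2ennreal (- u) + ennreal a + ennreal b * ennreal r"
    if "u \<le> ereal (a + b * r)" "0 \<le> r" for u r
  proof -
    have "- ereal (a + b * r) \<le> - u"
      using that(1) by (simp only: ereal_minus_le_minus)
    then have "e2ennreal u \<le> ennreal (a + b * r)" "ennreal (- (a + b * r)) \<le> e2ennreal (- u)"
      using e2ennreal_mono[OF that(1)] e2ennreal_mono[of "- ereal (a + b * r)" "- u"] by simp_all
    then show ?thesis
      unfolding ennreal_affine_le_iff[OF that(2)] by (subst add.commute) (rule add_mono)
  qed
  consider "y = 0" | "y = top" | r where "y = ennreal r" "0 < r"
    by (cases y) (auto simp: less_le)
  then show ?thesis
  proof cases
    case 1
    have "((\<lambda>t. ereal (a + b * t)) \<longlongrightarrow> ereal (a + b * 0)) (at_right 0)"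
      by (intro tendsto_intros)
    then have "utility_ext f 0 \<le> ereal (a + b * 0)"
    proof (rule tendsto_le[rotated, OF _ tendsto_utility_ext_0])
      show "eventually (\<lambda>t. ereal (f t) \<le> ereal (a + b * t)) (at_right 0)"
        using eventually_at_right_less[of 0] by eventually_elim (simp add: bound)
    qed simp
    from real[OF this] 1 show ?thesis by simp
  next
    case 3
    then have "utility_ext f y \<le> ereal (a + b * r)"
      using bound by (simp add: utility_ext_def)
    from real[OF this] 3 show ?thesis by simp
  next
    case 2
    \<comment> \<open>At infinity a positive \<open>b\<close> makes the right side infinite, and a
      negative \<open>b\<close> does so through the negative part of the utility; only
      \<open>b = 0\<close> needs a comparison of limits.\<close>
    consider "b > 0" | "b = 0" | "b < 0" by linarith
    then show ?thesis
    proof cases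
      case 1 then show ?thesis using 2 by (simp add: ennreal_mult_top)
    next
      case b: 2
      have "utility_ext f top \<le> ereal a"
      proof (rule tendsto_upperbound[OF tendsto_utility_ext_top])
        show "eventually (\<lambda>t. ereal (f t) \<le> ereal a) at_top"
          using eventually_gt_at_top[of 0] by eventually_elim (use bound b in simp)
      qed simp
      \<comment> \<open>With \<open>b = 0\<close> the products vanish even at \<open>top\<close>, so
        the instance of \<open>real\<close> at 0 is the claim.\<close>
      then show ?thesis using real[of "utility_ext f top" 0] 2 b by simp
    next
      case 3
      then have "((\<lambda>t. ereal (f t)) \<longlongrightarrow> - \<infinity>) at_top"
        using tendsto_MInfty_affine_bound bound by blast
      then have "utility_ext f top = - \<infinity>"
        using tendsto_unique[OF _ tendsto_utility_ext_top] by simp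
      then show ?thesis using 2 by simp
    qed
  qed
qed

end

section \<open>Measurability of utilities and ratios, and the logarithmic inequality\<close>

text \<open>A concave function on an open half-line is continuous, hence Borel there; the two
  endpoint values are patched in separately.\<close>

lemma borel_measurable_utility_ext:
  assumes "concave_on {0<..} f"
  shows "utility_ext f \<in> borel_measurable borel"
proof -
  have "continuous_on {0<..} (\<lambda>x. - f x)"
    using assms by (intro convex_on_continuous) (auto simp: concave_on_def)
  then have "continuous_on {0<..} f"
    using continuous_on_minus by fastforce
  then have [measurable]: "(\<lambda>x. indicator {0<..} x *\<^sub>R f x) \<in> borel_measurable borel"
    by (intro borel_measurable_continuous_on_indicator) auto
  have "utility_ext f = (\<lambda>x. if x = 0 then utility_ext f 0 else if x = top then utility_ext f top
      else ereal (indicator {0<..} (enn2real x) *\<^sub>R f (enn2real x)))"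
    by (auto simp: utility_ext_def fun_eq_iff indicator_def enn2real_positive_iff less_top zero_less_iff_neq_zero)
  also have "\<dots> \<in> borel_measurable borel" by measurable
  finally show ?thesis .
qed

lemma borel_measurable_log_ext [measurable]: "log_ext \<in> borel_measurable borel"
  unfolding log_ext_def[abs_def] by measurable

text \<open>This is \<open>ln x <= x - 1\<close> rearranged so that it makes sense on all of
  \<open>ennreal\<close>.\<close>

lemma log_ext_le: "e2ennreal (log_ext x) + 1 \<le> e2ennreal (- log_ext x) + x"
proof -
  consider "x = 0" | "x = top" | r where "x = ennreal r" "0 < r"
    by (cases x) (auto simp: less_le)
  then show ?thesis
  proof cases
    case 3
    have "max (ln r) 0 + 1 \<le> max (- ln r) 0 + r"
      using ln_le_minus_one[OF \<open>0 < r\<close>] by (auto simp: max_def)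
    then have "ennreal (max (ln r) 0 + 1) \<le> ennreal (max (- ln r) 0 + r)"
      by (rule ennreal_leI)
    with 3 show ?thesis by (simp add: log_ext_def ennreal_plus)
  qed (auto simp: log_ext_def)
qed

lemma borel_measurable_ratio [measurable (raw)]:
  assumes [measurable]: "f \<in> borel_measurable M" "g \<in> borel_measurable M"
  shows "(\<lambda>x. ratio (f x) (g x)) \<in> borel_measurable M"
  unfolding ratio_def by measurable

lemma expectation_cong_AE:
  assumes "AE \<omega> in P. Y \<omega> = Z \<omega>"
  shows "expectation_defined P Y \<longleftrightarrow> expectation_defined P Z"
    and "ext_expectation P Y = ext_expectation P Z"
proof -
  have "(\<integral>\<^sup>+ \<omega>. e2ennreal (Y \<omega>) \<partial>P) = (\<integral>\<^sup>+ \<omega>. e2ennreal (Z \<omega>) \<partial>P)"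
    "(\<integral>\<^sup>+ \<omega>. e2ennreal (- Y \<omega>) \<partial>P) = (\<integral>\<^sup>+ \<omega>. e2ennreal (- Z \<omega>) \<partial>P)"
    using assms by (auto intro!: nn_integral_cong_AE)
  then show "expectation_defined P Y \<longleftrightarrow> expectation_defined P Z"
    and "ext_expectation P Y = ext_expectation P Z"
    by (simp_all add: expectation_defined_def ext_expectation_def)
qed

section \<open>Conditional expectations of nonnegative functions and Jensen's inequality\<close>

context sigma_finite_subalgebra
begin

lemma nn_integral_nn_cond_exp:
  assumes "g \<in> borel_measurable M"
  shows "(\<integral>\<^sup>+ x. nn_cond_exp M F g x \<partial>M) = (\<integral>\<^sup>+ x. g x \<partial>M)"
  using nn_cond_exp_intg[of "\<lambda>_. 1" g] assms by simp

lemma nn_cond_exp_affine: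
  assumes [measurable]: "g \<in> borel_measurable M" "h \<in> borel_measurable M"
    and F [measurable]: "a \<in> borel_measurable F" "b \<in> borel_measurable F"
  shows "AE x in M. nn_cond_exp M F (\<lambda>x. g x + a x + b x * h x) x
    = nn_cond_exp M F g x + a x + b x * nn_cond_exp M F h x"
proof -
  note [measurable] = F[THEN measurable_from_subalg[OF subalg]]
  have "AE x in M. nn_cond_exp M F (\<lambda>x. g x + a x) x + nn_cond_exp M F (\<lambda>x. b x * h x) x
      = nn_cond_exp M F (\<lambda>x. g x + a x + b x * h x) x"
    by (rule nn_cond_exp_sum) measurable
  moreover have "AE x in M. nn_cond_exp M F g x + nn_cond_exp M F a x
      = nn_cond_exp M F (\<lambda>x. g x + a x) x"
    by (rule nn_cond_exp_sum) measurable
  moreover have "AE x in M. a x = nn_cond_exp M F a x"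
    by (rule nn_cond_exp_F_meas) measurable
  moreover have "AE x in M. b x * nn_cond_exp M F h x = nn_cond_exp M F (\<lambda>x. b x * h x) x"
    by (rule nn_cond_exp_prod) measurable
  ultimately show ?thesis by eventually_elim simp
qed

text \<open>Turns a pointwise tangent bound into a conditional one. The coefficients may vary with
  the point because they are \<open>F\<close>-measurable and so can be pulled out.\<close>

lemma nn_cond_exp_affine_mono:
  assumes [measurable]: "g \<in> borel_measurable M" "g' \<in> borel_measurable M" "h \<in> borel_measurable M"
    and F [measurable]: "a \<in> borel_measurable F" "a' \<in> borel_measurable F"
      "b \<in> borel_measurable F" "b' \<in> borel_measurable F"
    and le: "\<And>x. g x + a x + b x * h x \<le> g' x + a' x + b' x * h x"
  shows "AE x in M. nn_cond_exp M F g x + a x + b x * nn_cond_exp M F h x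
    \<le> nn_cond_exp M F g' x + a' x + b' x * nn_cond_exp M F h x"
proof -
  note [measurable] = F[THEN measurable_from_subalg[OF subalg]]
  have "AE x in M. nn_cond_exp M F (\<lambda>x. g x + a x + b x * h x) x
      \<le> nn_cond_exp M F (\<lambda>x. g' x + a' x + b' x * h x) x"
    by (rule nn_cond_exp_mono) (auto intro: le)
  moreover have "AE x in M. nn_cond_exp M F (\<lambda>x. g x + a x + b x * h x) x
    = nn_cond_exp M F g x + a x + b x * nn_cond_exp M F h x"
    by (rule nn_cond_exp_affine) measurable
  moreover have "AE x in M. nn_cond_exp M F (\<lambda>x. g' x + a' x + b' x * h x) x
    = nn_cond_exp M F g' x + a' x + b' x * nn_cond_exp M F h x"
    by (rule nn_cond_exp_affine) measurable
  ultimately show ?thesis by eventually_elim simp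
qed

text \<open>The event where the conditional expectation vanishes lies in \<open>F\<close>, so
  \<open>E\<close> has integral 0 over it.\<close>

lemma AE_eq_0_if_nn_cond_exp_eq_0:
  assumes [measurable]: "E \<in> borel_measurable M"
  shows "AE x in M. nn_cond_exp M F E x = 0 \<longrightarrow> E x = 0"
proof -
  define w :: "'a \<Rightarrow> ennreal" where "w x = (if nn_cond_exp M F E x = 0 then 1 else 0)" for x
  have w [measurable]: "w \<in> borel_measurable F" unfolding w_def[abs_def] by measurable
  note [measurable] = measurable_from_subalg[OF subalg w]
  have "(\<integral>\<^sup>+ x. w x * E x \<partial>M) = (\<integral>\<^sup>+ x. w x * nn_cond_exp M F E x \<partial>M)"
    by (rule nn_cond_exp_intg[symmetric]) measurable
  also have "\<dots> = (\<integral>\<^sup>+ x. 0 \<partial>M)" by (rule nn_integral_cong) (simp add: w_def)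
  finally have "AE x in M. w x * E x = 0" by (simp add: nn_integral_0_iff_AE)
  then show ?thesis by eventually_elim (simp add: w_def split: if_splits)
qed

text \<open>On that event \<open>h (E x)\<close> is almost surely the constant \<open>h 0\<close>.
  Its indicator \<open>w\<close> is \<open>F\<close>-measurable, so multiplying by \<open>w\<close>
  localizes the conditional expectation.\<close>

lemma nn_cond_exp_comp_if_eq_0:
  assumes [measurable]: "E \<in> borel_measurable M" "h \<in> borel_measurable borel"
  shows "AE x in M. nn_cond_exp M F E x = 0 \<longrightarrow> nn_cond_exp M F (\<lambda>x. h (E x)) x = h 0"
proof -
  define w :: "'a \<Rightarrow> ennreal" where "w x = (if nn_cond_exp M F E x = 0 then 1 else 0)" for x
  have w [measurable]: "w \<in> borel_measurable F" unfolding w_def[abs_def] by measurable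
  note [measurable] = measurable_from_subalg[OF subalg w]
  have "AE x in M. w x * h (E x) = w x * h 0"
    using AE_eq_0_if_nn_cond_exp_eq_0[OF assms(1)] by eventually_elim (simp add: w_def)
  then have "AE x in M. nn_cond_exp M F (\<lambda>x. w x * h (E x)) x = nn_cond_exp M F (\<lambda>x. w x * h 0) x"
    by (rule nn_cond_exp_cong) measurable
  moreover have "AE x in M. w x * h 0 = nn_cond_exp M F (\<lambda>x. w x * h 0) x"
    by (rule nn_cond_exp_F_meas) measurable
  moreover have "AE x in M. w x * nn_cond_exp M F (\<lambda>x. h (E x)) x = nn_cond_exp M F (\<lambda>x. w x * h (E x)) x"
    by (rule nn_cond_exp_prod) measurable
  ultimately show ?thesis
  proof eventually_elim
    case (elim x)
    then have "w x * nn_cond_exp M F (\<lambda>x. h (E x)) x = w x * h 0" by simp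
    then show ?case by (auto simp: w_def)
  qed
qed

lemma nn_cond_exp_utility_ext:
  assumes E [measurable]: "E \<in> borel_measurable M" and f: "concave_on {0<..} f"
  shows "AE x in M. nn_cond_exp M F (\<lambda>x. e2ennreal (utility_ext f (E x))) x
      + e2ennreal (- utility_ext f (nn_cond_exp M F E x))
    \<le> nn_cond_exp M F (\<lambda>x. e2ennreal (- utility_ext f (E x))) x
      + e2ennreal (utility_ext f (nn_cond_exp M F E x))"
proof -
  note [measurable] = borel_measurable_utility_ext[OF f]
  obtain d where [measurable]: "d \<in> borel_measurable borel"
    and d: "\<forall>x>0. \<forall>y>0. f y \<le> f x + d x * (y - x)"
    using concave_on_supergradient[OF f] by blast
  define G where "G = nn_cond_exp M F E"
  define p where "p = nn_cond_exp M F (\<lambda>x. e2ennreal (utility_ext f (E x)))"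
  define q where "q = nn_cond_exp M F (\<lambda>x. e2ennreal (- utility_ext f (E x)))"
  \<comment> \<open>The point of tangency; the dummy value \<open>1\<close> makes the tangent bound hold everywhere.\<close>
  define X where "X x = (if G x = 0 \<or> G x = top then 1 else enn2real (G x))" for x
  \<comment> \<open>The intercept of the tangent at \<open>X x\<close>. Going through
    \<open>utility_ext\<close> makes it visibly measurable, as \<open>f\<close> itself is arbitrary
    outside \<open>{0<..}\<close>.\<close>
  define a where "a x = real_of_ereal (utility_ext f (ennreal (X x))) - d (X x) * X x" for x
  have [measurable]: "G \<in> borel_measurable F" unfolding G_def by measurable
  have [measurable]: "X \<in> borel_measurable F" unfolding X_def[abs_def] by measurable
  have [measurable]: "a \<in> borel_measurable F" unfolding a_def[abs_def] by measurable
  have X: "0 < X x" for x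
    by (auto simp: X_def enn2real_positive_iff less_top zero_less_iff_neq_zero)
  have a: "a x = f (X x) - d (X x) * X x" for x
    using X[of x] by (simp add: a_def utility_ext_def)
  have finite: "AE x in M. p x + ennreal (- a x) + ennreal (- d (X x)) * G x
      \<le> q x + ennreal (a x) + ennreal (d (X x)) * G x"
    unfolding p_def q_def G_def
  proof (rule nn_cond_exp_affine_mono)
    fix x
    have "\<forall>y>0. f y \<le> a x + d (X x) * y"
      using d X[of x] by (simp add: a algebra_simps)
    then show "e2ennreal (utility_ext f (E x)) + ennreal (- a x) + ennreal (- d (X x)) * E x
        \<le> e2ennreal (- utility_ext f (E x)) + ennreal (a x) + ennreal (d (X x)) * E x"
      by (rule utility_ext_affine_bound[OF d])
  qed measurable
  have zero: "AE x in M. G x = 0 \<longrightarrow> p x = e2ennreal (utility_ext f 0)"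
    "AE x in M. G x = 0 \<longrightarrow> q x = e2ennreal (- utility_ext f 0)"
    unfolding p_def q_def G_def by (rule nn_cond_exp_comp_if_eq_0; measurable)+
  have top: "AE x in M. G x = top \<longrightarrow>
      p x + e2ennreal (- utility_ext f top) \<le> q x + e2ennreal (utility_ext f top)"
    using supergradient_mono_or_affine_bound[OF d]
  proof (elim disjE exE conjE)
    assume mono: "\<forall>x y. 0 < x \<longrightarrow> x \<le> y \<longrightarrow> f x \<le> f y"
    have le: "utility_ext f y \<le> utility_ext f top" for y
      by (rule utility_ext_le_top[OF d]) (use mono in auto)
    \<comment> \<open>The constant bound by the value at infinity is an affine bound with slope 0,
      and \<open>0 * G x\<close> is 0 even for infinite \<open>G x\<close>.\<close>
    have "AE x in M. p x + e2ennreal (- utility_ext f top) + 0 * G x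
        \<le> q x + e2ennreal (utility_ext f top) + 0 * G x"
      unfolding p_def q_def G_def
    proof (rule nn_cond_exp_affine_mono)
      fix x
      have "e2ennreal (utility_ext f (E x)) + e2ennreal (- utility_ext f top)
          \<le> e2ennreal (utility_ext f top) + e2ennreal (- utility_ext f (E x))"
        by (intro add_mono e2ennreal_mono) (simp_all add: le)
      then show "e2ennreal (utility_ext f (E x)) + e2ennreal (- utility_ext f top) + 0 * E x
          \<le> e2ennreal (- utility_ext f (E x)) + e2ennreal (utility_ext f top) + 0 * E x"
        by (simp add: add.commute)
    qed measurable
    then show ?thesis by eventually_elim simp
  next
    fix a b :: real assume "b < 0" and ab: "\<forall>y>0. f y \<le> a + b * y"
    have "AE x in M. p x + ennreal (- a) + ennreal (- b) * G x
        \<le> q x + ennreal a + ennreal b * G x"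
      unfolding p_def q_def G_def
      by (rule nn_cond_exp_affine_mono)
        (measurable, rule utility_ext_affine_bound[OF d ab])
    \<comment> \<open>Where \<open>G x = top\<close>, the term \<open>ennreal (- b) * G x\<close> is
      infinite while \<open>ennreal b\<close> is 0, so \<open>q x\<close> must be infinite.\<close>
    then show ?thesis
      by eventually_elim (use \<open>b < 0\<close> in \<open>auto simp: ennreal_mult_top ennreal_neg top_unique\<close>)
  qed
  have "AE x in M. p x + e2ennreal (- utility_ext f (G x)) \<le> q x + e2ennreal (utility_ext f (G x))"
    using finite zero top
  proof eventually_elim
    case (elim x)
    consider "G x = 0" | "G x = top" | r where "G x = ennreal r" "0 < r"
      by (cases "G x") (auto simp: less_le)
    then show ?case
    proof cases
      case 3
      then have "X x = r" by (simp add: X_def)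
      \<comment> \<open>The tangency point is now \<open>G x\<close> itself, where the tangent takes
        the value of \<open>f\<close>.\<close>
      then have "f r = a x + d r * r" by (simp add: a)
      moreover have "p x + ennreal (- (a x + d r * r)) \<le> q x + ennreal (a x + d r * r)"
        using elim(1) 3(1) unfolding \<open>X x = r\<close>
        by (subst ennreal_affine_le_iff[symmetric]) (use \<open>0 < r\<close> in auto)
      ultimately show ?thesis
        using 3 by (simp add: utility_ext_def)
    qed (use elim in \<open>simp_all add: add.commute\<close>)
  qed
  then show ?thesis by (simp add: p_def q_def G_def)
qed

text \<open>Integrating the conditional inequality replaces conditional expectations by means;
  definedness of both expectations then permits subtraction.\<close>

lemma ext_expectation_utility_ext_le:
  assumes E [measurable]: "E \<in> borel_measurable M" and f: "concave_on {0<..} f"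
    and "expectation_defined M (\<lambda>x. utility_ext f (E x))"
    and "expectation_defined M (\<lambda>x. utility_ext f (nn_cond_exp M F E x))"
  shows "ext_expectation M (\<lambda>x. utility_ext f (E x))
    \<le> ext_expectation M (\<lambda>x. utility_ext f (nn_cond_exp M F E x))"
proof -
  note [measurable] = borel_measurable_utility_ext[OF f]
  have "(\<integral>\<^sup>+ x. e2ennreal (utility_ext f (E x)) \<partial>M)
      + (\<integral>\<^sup>+ x. e2ennreal (- utility_ext f (nn_cond_exp M F E x)) \<partial>M)
    \<le> (\<integral>\<^sup>+ x. e2ennreal (- utility_ext f (E x)) \<partial>M)
      + (\<integral>\<^sup>+ x. e2ennreal (utility_ext f (nn_cond_exp M F E x)) \<partial>M)"
    using nn_integral_mono_AE[OF nn_cond_exp_utility_ext[OF E f]]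
    by (simp add: nn_integral_add nn_integral_nn_cond_exp)
  then show ?thesis
    unfolding ext_expectation_def
    by (rule ereal_diff_le_diffI) (use assms(3,4) in \<open>auto simp: expectation_defined_def\<close>)
qed

text \<open>Where the conditional expectation \<open>G\<close> is positive and finite, its inverse
  can be pulled out and cancels. Where \<open>G\<close> is infinite the ratio is at most 1, and
  where \<open>G\<close> is 0 it is almost surely \<open>0 / 0 = 0\<close>.\<close>

lemma nn_integral_ratio_nn_cond_exp_le:
  assumes [measurable]: "E \<in> borel_measurable M"
  shows "(\<integral>\<^sup>+ x. ratio (E x) (nn_cond_exp M F E x) \<partial>M) \<le> emeasure M (space M)"
proof -
  define G where "G = nn_cond_exp M F E"
  define v :: "'a \<Rightarrow> ennreal" where "v x = (if G x = top then 1 else 0)" for x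
  define w where "w x = (if G x = 0 \<or> G x = top then 0 else inverse (G x))" for x
  have G [measurable]: "G \<in> borel_measurable F" unfolding G_def by measurable
  have F [measurable]: "v \<in> borel_measurable F" "w \<in> borel_measurable F"
    unfolding v_def[abs_def] w_def[abs_def] by measurable
  note [measurable] = F[THEN measurable_from_subalg[OF subalg]] measurable_from_subalg[OF subalg G]
  have "(\<integral>\<^sup>+ x. ratio (E x) (G x) \<partial>M) \<le> (\<integral>\<^sup>+ x. v x + w x * E x \<partial>M)"
  proof (rule nn_integral_mono_AE)
    show "AE x in M. ratio (E x) (G x) \<le> v x + w x * E x"
      using AE_eq_0_if_nn_cond_exp_eq_0[OF assms] unfolding G_def[symmetric]
      by eventually_elim
        (auto simp: ratio_def v_def w_def divide_ennreal_def mult.commute)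
  qed
  also have "\<dots> = (\<integral>\<^sup>+ x. v x \<partial>M) + (\<integral>\<^sup>+ x. w x * G x \<partial>M)"
    by (simp add: nn_integral_add nn_cond_exp_intg G_def)
  \<comment> \<open>The recombined integrand is the indicator of the event that \<open>G\<close> is
    nonzero.\<close>
  also have "\<dots> = (\<integral>\<^sup>+ x. v x + w x * G x \<partial>M)" by (simp add: nn_integral_add)
  also have "\<dots> \<le> (\<integral>\<^sup>+ x. 1 \<partial>M)"
  proof (rule nn_integral_mono)
    fix x
    show "v x + w x * G x \<le> 1"
      by (cases "G x = 0 \<or> G x = top")
        (auto simp: v_def w_def mult.commute[of "inverse _"] divide_ennreal_def[symmetric] ennreal_divide_self less_top)
  qed
  finally show ?thesis by (simp add: G_def)
qed

end

section \<open>Expectation of the logarithm of a variable with mean at most 1\<close>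

lemma log_ext_expectation_nonpos:
  assumes "prob_space M" and "r \<in> borel_measurable M" and r: "(\<integral>\<^sup>+ x. r x \<partial>M) \<le> 1"
  shows "expectation_defined M (\<lambda>x. log_ext (r x)) \<and> ext_expectation M (\<lambda>x. log_ext (r x)) \<le> 0"
proof -
  interpret prob_space M by fact
  note [measurable] = \<open>r \<in> borel_measurable M\<close>
  let ?p = "\<integral>\<^sup>+ x. e2ennreal (log_ext (r x)) \<partial>M" and ?q = "\<integral>\<^sup>+ x. e2ennreal (- log_ext (r x)) \<partial>M"
  have "?p + 1 \<le> ?q + (\<integral>\<^sup>+ x. r x \<partial>M)"
    using nn_integral_mono[of M "\<lambda>x. e2ennreal (log_ext (r x)) + 1"
        "\<lambda>x. e2ennreal (- log_ext (r x)) + r x"] log_ext_le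
    by (simp add: nn_integral_add emeasure_space_1)
  also have "\<dots> \<le> ?q + 1" using r by (rule add_left_mono)
  finally have pq: "?p \<le> ?q" by (simp add: ennreal_add_left_cancel_le add.commute[of _ 1])
  \<comment> \<open>Bounding the positive part of the logarithm by \<open>x\<close> makes its
    integral finite, so the expectation is defined.\<close>
  have "e2ennreal (log_ext x) \<le> x" for x
  proof (cases "1 \<le> x")
    case True
    then have "0 \<le> log_ext x" by (cases x) (auto simp: log_ext_def)
    then have "e2ennreal (- log_ext x) = 0" by (simp add: e2ennreal_neg)
    then have "e2ennreal (log_ext x) + 1 \<le> x" using log_ext_le[of x] by simp
    then show ?thesis by (rule order_trans[rotated]) simp
  next
    case False
    then have "log_ext x \<le> 0"
      by (cases x) (auto simp: log_ext_def ennreal_ge_1)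
    then show ?thesis by (simp add: e2ennreal_neg)
  qed
  then have "?p \<le> (\<integral>\<^sup>+ x. r x \<partial>M)" by (intro nn_integral_mono)
  also note r
  finally have "?p < \<infinity>" by (rule le_less_trans) simp
  then show ?thesis
    using pq ereal_diff_le_diffI[of ?p 0 ?q 0]
    by (auto simp: expectation_defined_def ext_expectation_def zero_ennreal.rep_eq)
qed

section \<open>Common versions as nonnegative conditional expectations\<close>

text \<open>The negative part of \<open>E\<close> is 0. Hence the expectation is defined under every
  parameter, and the generalized conditional expectation reduces almost surely to its first
  term.\<close>

lemma common_cond_exp_AE_nn_cond_exp:
  assumes G: "common_cond_exp P \<Theta> F N S (\<lambda>\<omega>. enn2ereal (E \<omega>)) (\<lambda>\<omega>. enn2ereal (G \<omega>))"
    and \<theta>: "\<theta> \<in> \<Theta>" and P: "prob_space (P \<theta>)" and F: "subalgebra (P \<theta>) F"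
    and S: "S \<in> F \<rightarrow>\<^sub>M N" and E: "E \<in> borel_measurable F"
  shows "sigma_finite_subalgebra (P \<theta>) (vimage_algebra (space F) S N)"
    and "AE \<omega> in P \<theta>. G \<omega> = nn_cond_exp (P \<theta>) (vimage_algebra (space F) S N) E \<omega>"
proof -
  let ?V = "vimage_algebra (space F) S N"
  interpret prob_space "P \<theta>" by fact
  have "sets ?V \<subseteq> sets F"
    using S unfolding sets_vimage_algebra
    by (intro sets.sigma_sets_subset) (auto simp: measurable_sets)
  then have sub: "subalgebra (P \<theta>) ?V" using F by (auto simp: subalgebra_def)
  interpret V: finite_measure_subalgebra "P \<theta>" ?V by standard (rule sub)
  show "sigma_finite_subalgebra (P \<theta>) ?V" by unfold_locales
  have neg: "e2ennreal (- enn2ereal x) = 0" for x by (simp add: e2ennreal_neg)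
  then have "expectation_defined (P \<theta>) (\<lambda>\<omega>. enn2ereal (E \<omega>))"
    by (simp add: expectation_defined_def)
  with G \<theta> obtain g where g: "\<forall>\<omega>\<in>space F. enn2ereal (G \<omega>) = g (S \<omega>)"
    and AE_g: "AE \<omega> in P \<theta>. ext_cond_exp (P \<theta>) ?V (\<lambda>\<omega>. enn2ereal (E \<omega>)) \<omega> = g (S \<omega>)"
    unfolding common_cond_exp_def by blast
  \<comment> \<open>The subtracted term is a conditional expectation of the zero function, which is
    pinned down only almost surely.\<close>
  have "AE \<omega> in P \<theta>. 0 = nn_cond_exp (P \<theta>) ?V (\<lambda>_. 0) \<omega>"
    by (rule V.nn_cond_exp_F_meas) simp
  then have "AE \<omega> in P \<theta>. enn2ereal (G \<omega>) = enn2ereal (nn_cond_exp (P \<theta>) ?V E \<omega>)"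
    using AE_g AE_space
  proof eventually_elim
    case (elim \<omega>)
    have "\<omega> \<in> space F" using elim(3) F by (simp add: subalgebra_def)
    with g elim(2) have "enn2ereal (G \<omega>) = ext_cond_exp (P \<theta>) ?V (\<lambda>\<omega>. enn2ereal (E \<omega>)) \<omega>" by simp
    then show ?case by (simp add: ext_cond_exp_def neg elim(1)[symmetric] zero_ennreal.rep_eq)
  qed
  then show "AE \<omega> in P \<theta>. G \<omega> = nn_cond_exp (P \<theta>) ?V E \<omega>"
    by (simp add: enn2ereal_inject)
qed

text \<open>Almost sure equalities do not yield measurability with respect to \<open>F\<close>; it
  comes from the factorization of \<open>G\<close> through \<open>S\<close>.\<close>

lemma common_cond_exp_measurable:
  assumes "common_cond_exp P \<Theta> F N S h (\<lambda>\<omega>. enn2ereal (G \<omega>))" and [measurable]: "S \<in> F \<rightarrow>\<^sub>M N"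
  shows "G \<in> borel_measurable F"
proof -
  obtain g where [measurable]: "g \<in> borel_measurable N"
    and g: "\<forall>\<omega>\<in>space F. enn2ereal (G \<omega>) = g (S \<omega>)"
    using assms(1) unfolding common_cond_exp_def by blast
  have "(\<lambda>\<omega>. e2ennreal (g (S \<omega>))) \<in> borel_measurable F" by measurable
  moreover have "G \<omega> = e2ennreal (g (S \<omega>))" if "\<omega> \<in> space F" for \<omega>
    using g that by (metis e2ennreal_enn2ereal)
  ultimately show ?thesis by (simp cong: measurable_cong)
qed

theorem corollary2p13:
  fixes M :: "'a measure" and F :: "nat \<Rightarrow> 'a measure"
    and P :: "'t \<Rightarrow> 'a measure" and \<Theta> \<Theta>0 \<Theta>1 :: "'t set"
    and N :: "nat \<Rightarrow> 's measure" and S :: "nat \<Rightarrow> 'a \<Rightarrow> 's"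
    and E G :: "nat \<Rightarrow> 'a \<Rightarrow> ennreal"
  assumes P_prob: "\<And>\<theta>. \<theta> \<in> \<Theta> \<Longrightarrow> prob_space (P \<theta>)"
    and P_sets: "\<And>\<theta>. \<theta> \<in> \<Theta> \<Longrightarrow> sets (P \<theta>) = sets M"
    and F_filtration: "filtration (space M) F"
    and F_sub: "\<And>n. subalgebra M (F n)"
    and partition: "\<Theta> = \<Theta>0 \<union> \<Theta>1" "\<Theta>0 \<inter> \<Theta>1 = {}"
    and S_sufficient: "\<And>n. sufficient_statistic P \<Theta> (F n) (N n) (S n)"
    and E_meas: "\<And>n. E n \<in> borel_measurable (F n)"
    and E_evar: "asymptotic_evariable M P \<Theta>0 E \<or> uniform_asymptotic_evariable M P \<Theta>0 E"
    and G: "\<And>n. common_cond_exp P \<Theta> (F n) (N n) (S n)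
                    (\<lambda>\<omega>. enn2ereal (E n \<omega>)) (\<lambda>\<omega>. enn2ereal (G n \<omega>))"
  shows "(asymptotic_evariable M P \<Theta>0 E \<longrightarrow> asymptotic_evariable M P \<Theta>0 G) \<and>
         (uniform_asymptotic_evariable M P \<Theta>0 E \<longrightarrow> uniform_asymptotic_evariable M P \<Theta>0 G) \<and>
         (\<forall>n. \<forall>\<theta>\<in>\<Theta>. \<forall>f. concave_on {0<..} f \<longrightarrow>
            expectation_defined (P \<theta>) (\<lambda>\<omega>. utility_ext f (G n \<omega>)) \<longrightarrow>
            expectation_defined (P \<theta>) (\<lambda>\<omega>. utility_ext f (E n \<omega>)) \<longrightarrow>
            ext_expectation (P \<theta>) (\<lambda>\<omega>. utility_ext f (G n \<omega>))
              \<ge> ext_expectation (P \<theta>) (\<lambda>\<omega>. utility_ext f (E n \<omega>))) \<and>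
         (\<forall>n. \<forall>\<theta>\<in>\<Theta>.
            expectation_defined (P \<theta>) (\<lambda>\<omega>. log_ext (ratio (E n \<omega>) (G n \<omega>))) \<and>
            ext_expectation (P \<theta>) (\<lambda>\<omega>. log_ext (ratio (E n \<omega>) (G n \<omega>))) \<le> 0)"
proof -
  define V where "V n = vimage_algebra (space (F n)) (S n) (N n)" for n
  have S: "S n \<in> F n \<rightarrow>\<^sub>M N n" for n
    using S_sufficient by (simp add: sufficient_statistic_def)
  have sub: "subalgebra (P \<theta>) (F n)" if "\<theta> \<in> \<Theta>" for \<theta> n
    using F_sub[of n] P_sets[OF that] sets_eq_imp_space_eq[OF P_sets[OF that]]
    by (simp add: subalgebra_def)
  have sfs: "sigma_finite_subalgebra (P \<theta>) (V n)"
    and G_AE: "AE \<omega> in P \<theta>. G n \<omega> = nn_cond_exp (P \<theta>) (V n) (E n) \<omega>" if "\<theta> \<in> \<Theta>" for \<theta> n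
    unfolding V_def
    by (rule common_cond_exp_AE_nn_cond_exp[OF G that P_prob[OF that] sub[OF that] S E_meas])+
  have E [measurable]: "E n \<in> borel_measurable (P \<theta>)" if "\<theta> \<in> \<Theta>" for \<theta> n
    using measurable_from_subalg[OF sub[OF that] E_meas] .
  have G_meas: "G n \<in> borel_measurable M" for n
    by (rule measurable_from_subalg[OF F_sub common_cond_exp_measurable[OF G S]])
  \<comment> \<open>Equal means under each null parameter transfer the pointwise and the uniform
    bound alike.\<close>
  have mean: "(\<integral>\<^sup>+ \<omega>. G n \<omega> \<partial>P \<theta>) = (\<integral>\<^sup>+ \<omega>. E n \<omega> \<partial>P \<theta>)" if "\<theta> \<in> \<Theta>0" for n \<theta>
  proof -
    have \<theta>: "\<theta> \<in> \<Theta>" using that partition by simp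
    show ?thesis
      using nn_integral_cong_AE[OF G_AE[OF \<theta>]]
        sigma_finite_subalgebra.nn_integral_nn_cond_exp[OF sfs E, OF \<theta> \<theta>] by simp
  qed
  have "ext_expectation (P \<theta>) (\<lambda>\<omega>. utility_ext f (E n \<omega>))
      \<le> ext_expectation (P \<theta>) (\<lambda>\<omega>. utility_ext f (G n \<omega>))"
    if \<theta>: "\<theta> \<in> \<Theta>" and f: "concave_on {0<..} f"
      and defined: "expectation_defined (P \<theta>) (\<lambda>\<omega>. utility_ext f (G n \<omega>))"
        "expectation_defined (P \<theta>) (\<lambda>\<omega>. utility_ext f (E n \<omega>))" for n \<theta> f
  proof -
    \<comment> \<open>The version \<open>nn_cond_exp\<close> depends on the parameter while
      \<open>G n\<close> does not, so results are carried over separately under each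
      \<open>P \<theta>\<close>.\<close>
    have "AE \<omega> in P \<theta>. utility_ext f (G n \<omega>) = utility_ext f (nn_cond_exp (P \<theta>) (V n) (E n) \<omega>)"
      using G_AE[OF \<theta>, of n] by eventually_elim simp
    note cong = expectation_cong_AE[OF this]
    show ?thesis
      using sigma_finite_subalgebra.ext_expectation_utility_ext_le[OF sfs[OF \<theta>] E[OF \<theta>] f]
        defined cong by simp
  qed
  moreover have "expectation_defined (P \<theta>) (\<lambda>\<omega>. log_ext (ratio (E n \<omega>) (G n \<omega>))) \<and>
      ext_expectation (P \<theta>) (\<lambda>\<omega>. log_ext (ratio (E n \<omega>) (G n \<omega>))) \<le> 0"
    if \<theta>: "\<theta> \<in> \<Theta>" for n \<theta>
  proof (rule log_ext_expectation_nonpos[OF P_prob[OF \<theta>]])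
    have [measurable]: "G n \<in> borel_measurable (P \<theta>)"
      using G_meas P_sets[OF \<theta>] by (simp cong: measurable_cong_sets)
    show "(\<lambda>\<omega>. ratio (E n \<omega>) (G n \<omega>)) \<in> borel_measurable (P \<theta>)"
      using E[OF \<theta>] by measurable
    have "(\<integral>\<^sup>+ \<omega>. ratio (E n \<omega>) (G n \<omega>) \<partial>P \<theta>)
        = (\<integral>\<^sup>+ \<omega>. ratio (E n \<omega>) (nn_cond_exp (P \<theta>) (V n) (E n) \<omega>) \<partial>P \<theta>)"
      using G_AE[OF \<theta>, of n] by (intro nn_integral_cong_AE) auto
    also have "\<dots> \<le> emeasure (P \<theta>) (space (P \<theta>))"
      by (rule sigma_finite_subalgebra.nn_integral_ratio_nn_cond_exp_le[OF sfs[OF \<theta>] E[OF \<theta>]])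
    finally show "(\<integral>\<^sup>+ \<omega>. ratio (E n \<omega>) (G n \<omega>) \<partial>P \<theta>) \<le> 1"
      using prob_space.emeasure_space_1[OF P_prob[OF \<theta>]] by simp
  qed
  ultimately show ?thesis
    using G_meas mean by (auto simp: asymptotic_evariable_def uniform_asymptotic_evariable_def)
qed

end
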